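(* Let $b$ be a real constant with $|b|<1$, let $q\in\{1,2,3,4\}$, let $0\le T_0\le T<\infty$, and let $c_{CFL}>0$ be any constant. There is a constant $C$, independent of $\varepsilon$, $N$ and $\Delta t$, such that for every $\varepsilon>0$, every integer $N\ge 1$ and every $\Delta t>0$ with $\Delta t\le c_{CFL}/N^2$, the sequence $(U_N^n,W_N^n)_{n\ge 0}$ in $\mathbb{P}_N$ generated from starting values $U_N^0,\dots,U_N^{q-1},W_N^0,\dots,W_N^{q-1}\in\mathbb{P}_N$ by the $q$-th order IMEX-BDF scheme $$\begin{aligned}&\sum_{i=0}^q\alpha_iU_N^{n+i}+\Delta t\sum_{i=0}^{q-1}\gamma_i\,\partial_x\big(bU_N^{n+i}+W_N^{n+i}\big)=0,\\ &\sum_{i=0}^q\alpha_iW_N^{n+i}+\Delta t\sum_{i=0}^{q-1}\gamma_i\,\partial_x\big((1-b^2)U_N^{n+i}-bW_N^{n+i}\big)=-\frac{\beta\Delta t}{\varepsilon}W_N^{n+q},\qquad n\ge 0,\end{aligned}$$ satisfies $$\|U_N^n\|^2+\|W_N^n\|^2\le C\sum_{i=0}^{q-1}\left(\|U_N^i\|^2+\Big(1+\frac{\Delta t}{\varepsilon}\Big)\|W_N^i\|^2\right)$$ for every $n\geq 0$ such that $t_n=T_0+n\Delta t\le T$.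
   Context: $\mathbb{P}_N=\mathrm{span}\{e^{ikx}: -N\le k\le N\}$ is the (complex) space of trigonometric polynomials of degree at most $N$ on $[0,2\pi]$, and $\|\cdot\|$ is the $L^2$ norm in $x$ over $[0,2\pi]$. The coefficients of the $q$-th order IMEX-BDF scheme are defined by $$\beta=\frac{1}{\sum_{j=1}^q\frac1j},\qquad \sum_{i=0}^q\alpha_i\zeta^i=\beta\sum_{j=1}^q\frac1j\,\zeta^{q-j}(\zeta-1)^j,\qquad \sum_{i=0}^{q-1}\gamma_i\zeta^i=\beta\big(\zeta^q-(\zeta-1)^q\big).$$ (Here $\alpha_q=1$, so the scheme determines $U_N^{n+q}$ and $W_N^{n+q}$ uniquely.) The constant $C$ may depend on $b,q,c_{CFL},T$. *)

theory Defs
  imports "HOL-Analysis.Analysis" "HOL-Computational_Algebra.Polynomial"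
begin

definition bdf_beta :: "nat \<Rightarrow> real" where
  "bdf_beta q = 1 / (\<Sum>j=1..q. 1 / real j)"

(* In the two generating polynomials, zeta is the polynomial indeterminate:
   monom 1 k is zeta^k and [:-1, 1:] is zeta - 1. *)

definition bdf_alpha :: "nat \<Rightarrow> nat \<Rightarrow> real" where
  "bdf_alpha q i =
     coeff (smult (bdf_beta q)
       (\<Sum>j=1..q. smult (1 / real j) (monom 1 (q - j) * [:-1, 1:] ^ j))) i"

definition bdf_gamma :: "nat \<Rightarrow> nat \<Rightarrow> real" where
  "bdf_gamma q i = coeff (smult (bdf_beta q) (monom 1 q - [:-1, 1:] ^ q)) i"

(* Trigonometric polynomials are represented by their 2 pi-periodic extensions to the real line. *)

definition trig_polys :: "nat \<Rightarrow> (real \<Rightarrow> complex) set" where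
  "trig_polys N =
     {f. \<exists>c :: int \<Rightarrow> complex.
        f = (\<lambda>x. \<Sum>k = - int N..int N. c k * exp (\<i> * of_int k * complex_of_real x))}"

definition L2norm :: "(real \<Rightarrow> complex) \<Rightarrow> real" where
  "L2norm f = sqrt (set_lebesgue_integral lborel {0..2 * pi} (\<lambda>x. (cmod (f x))\<^sup>2))"

abbreviation ddx :: "(real \<Rightarrow> complex) \<Rightarrow> real \<Rightarrow> complex" where
  "ddx f x \<equiv> vector_derivative f (at x)"

(* U n and W n are the numerical solutions at time level n, as functions of x. *)

definition imex_bdf_scheme ::
  "nat \<Rightarrow> real \<Rightarrow> real \<Rightarrow> real \<Rightarrow> (nat \<Rightarrow> real \<Rightarrow> complex) \<Rightarrow> (nat \<Rightarrow> real \<Rightarrow> complex) \<Rightarrow> bool"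
where
  "imex_bdf_scheme q b \<epsilon> \<Delta>t U W \<longleftrightarrow>
     (\<forall>n x.
        (\<Sum>i=0..q. bdf_alpha q i *\<^sub>R U (n + i) x)
          + \<Delta>t *\<^sub>R (\<Sum>i<q. bdf_gamma q i *\<^sub>R
              ddx (\<lambda>y. b *\<^sub>R U (n + i) y + W (n + i) y) x) = 0 \<and>
        (\<Sum>i=0..q. bdf_alpha q i *\<^sub>R W (n + i) x)
          + \<Delta>t *\<^sub>R (\<Sum>i<q. bdf_gamma q i *\<^sub>R
              ddx (\<lambda>y. (1 - b\<^sup>2) *\<^sub>R U (n + i) y - b *\<^sub>R W (n + i) y) x)
          = - ((bdf_beta q * \<Delta>t / \<epsilon>) *\<^sub>R W (n + q) x))"

end

theory Submission
  imports Defs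
begin

text \<open>
  A Fourier transform in \<open>x\<close> turns the scheme into one two-component multistep recurrence
  for each wave number \<open>k\<close>, with \<open>\<partial>\<^sub>x\<close> replaced by \<open>\<i> k\<close>. Parseval's identity turns a bound for
  a single mode into the \<open>L\<^sup>2\<close> bound, as long as its constant depends neither on \<open>k\<close> nor on the
  stiffness \<open>\<kappa> = \<beta> \<Delta>t / \<epsilon>\<close>. Two parameters describe a mode: \<open>\<kappa> \<ge> 0\<close> and \<open>\<xi> = k \<Delta>t\<close>. The step
  size restriction gives \<open>\<xi>\<^sup>2 \<le> c \<Delta>t\<close>, so that growth by a factor \<open>1 + L \<xi>\<^sup>2\<close> per step is
  harmless, whereas growth by \<open>1 + L \<bar>\<xi>\<bar>\<close> would not be. The whole proof consists in getting rid of
  the contributions of first order in \<open>\<xi>\<close>.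

  Both equations are tested with the Nevanlinna--Odeh multiplier \<open>m z = z\<^sub>n\<^sub>+\<^sub>q - z\<^sub>n\<^sub>+\<^sub>q\<^sub>-\<^sub>1 / 2\<close>.
  The weight \<open>1/2\<close> serves all orders \<open>q \<le> 4\<close>: the BDF difference times the multiplier dominates
  the increment of a positive definite quadratic form \<open>G\<close> and, since the weight is positive,
  additionally a multiple of \<^emph>\<open>all\<close> squared first differences \<open>z\<^sub>n\<^sub>+\<^sub>i\<^sub>+\<^sub>1 - z\<^sub>n\<^sub>+\<^sub>i\<close>. For each order
  this is an explicit identity between quadratic forms (\<open>bdf2_G_stable\<close> and its companions).

  The flux matrix with rows \<open>(b, 1)\<close> and \<open>(1 - b\<^sup>2, -b)\<close> becomes symmetric when the first equation
  is weighted by \<open>1 - b\<^sup>2 > 0\<close>. Hence \<open>\<i> \<xi>\<close> times the flux of \<open>m\<close>, tested with \<open>m\<close> itself, has no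
  real part. The extrapolated values differ from \<open>2 \<beta> m\<close> only by a combination of first
  differences (\<open>extrapolation_defect\<close>), because the \<open>\<gamma>\<^sub>i\<close> sum up to \<open>\<beta>\<close>. The remaining flux term is
  therefore \<open>\<bar>\<xi>\<bar>\<close> times differences times \<open>m\<close>; Young's inequality splits it into a part absorbed by the
  dissipation and a part of size \<open>\<xi>\<^sup>2 \<bar>m\<bar>\<^sup>2\<close>. The multiplier involves the new time level, which
  the scheme itself controls by the old ones (\<open>new_level_bound\<close>); the Gronwall argument is thus
  explicit and needs no smallness of \<open>\<Delta>t\<close>.

  Finally the relaxation term tested with \<open>m w\<close> has the good sign up to the increment of
  \<open>\<kappa> \<bar>w\<bar>\<^sup>2 / 4\<close> (\<open>relaxation_dissipates\<close>). Adding this quantity to the energy accounts for the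
  weight \<open>1 + \<Delta>t / \<epsilon>\<close> on the starting values of \<open>W\<close>. These ingredients combine in
  \<open>mode_energy_growth\<close>, whose iteration is \<open>mode_stability\<close>.
\<close>
section \<open>Coefficients of the schemes\<close>

text \<open>Every summand \<open>\<zeta>\<^bsup>q-j\<^esup> (\<zeta> - 1)\<^bsup>j\<^esup> / j\<close> has degree \<open>q\<close> and leading coefficient \<open>1 / j\<close>, and
  \<open>\<beta>\<close> is the reciprocal of the sum of these.\<close>
lemma bdf_alpha_lead:
  assumes "q \<ge> 1"
  shows "bdf_alpha q q = 1"
proof -
  have lead: "coeff (monom 1 (q - j) * [:-1, 1:] ^ j) q = (1::real)" if "j \<in> {1..q}" for j
  proof -
    have "coeff (monom 1 (q - j) * [:-1, 1:] ^ j) q = coeff ([:-1, 1::real:] ^ j) j"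
      using that by (simp add: coeff_monom_mult)
    also have "\<dots> = 1"
      using coeff_linear_power[of "-1::real" j] by simp
    finally show ?thesis .
  qed
  have "(\<Sum>j=1..q. 1 / real j) > 0"
    using assms by (intro sum_pos) auto
  then show ?thesis
    using lead by (simp add: bdf_alpha_def bdf_beta_def coeff_sum)
qed

text \<open>The sum of the coefficients is the value at \<open>\<zeta> = 1\<close> of \<open>\<beta> (\<zeta>\<^sup>q - (\<zeta> - 1)\<^sup>q)\<close>, a polynomial
  whose terms of degree \<open>q\<close> cancel. It expresses that the explicit part extrapolates constants
  to \<open>\<beta>\<close> times themselves.\<close>
lemma sum_bdf_gamma:
  assumes "q \<ge> 1"
  shows "(\<Sum>i<q. bdf_gamma q i) = bdf_beta q"
proof -
  define p where "p = smult (bdf_beta q) (monom 1 q - [:-1, 1:] ^ q)"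
  have top: "coeff p q = 0"
    using coeff_linear_power[of "-1::real" q] by (simp add: p_def)
  have "degree p \<le> q"
    unfolding p_def
    by (intro order.trans[OF degree_smult_le] degree_diff_le)
      (simp_all add: degree_monom_eq degree_linear_power)
  then have "poly p 1 = (\<Sum>i\<le>q. coeff p i)"
    by (simp add: poly_altdef sum.mono_neutral_left coeff_eq_0)
  also have "\<dots> = (\<Sum>i<q. coeff p i)"
    by (simp add: lessThan_Suc_atMost[symmetric] top)
  finally show ?thesis
    using assms by (simp add: p_def poly_monom bdf_gamma_def power_0_left)
qed

lemma bdf_beta_pos: "q \<ge> 1 \<Longrightarrow> 0 < bdf_beta q"
  by (auto simp: bdf_beta_def intro!: sum_pos)

lemma bdf_beta_le_1:
  assumes "q \<ge> 1"
  shows "bdf_beta q \<le> 1"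
proof -
  have "1 / real 1 \<le> (\<Sum>j=1..q. 1 / real j)"
    using assms by (intro member_le_sum) auto
  then show ?thesis
    by (simp add: bdf_beta_def divide_le_eq_1)
qed

lemma bdf_alpha_1: "bdf_alpha 1 0 = -1" "bdf_alpha 1 1 = 1"
  by (simp_all add: bdf_alpha_def bdf_beta_def)

lemma bdf_alpha_2: "bdf_alpha 2 0 = 1/3" "bdf_alpha 2 1 = -4/3" "bdf_alpha 2 2 = 1"
  by (simp_all add: bdf_alpha_def bdf_beta_def numeral_eq_Suc monom_altdef)

lemma bdf_alpha_3:
  "bdf_alpha 3 0 = -2/11" "bdf_alpha 3 1 = 9/11" "bdf_alpha 3 2 = -18/11" "bdf_alpha 3 3 = 1"
  by (simp_all add: bdf_alpha_def bdf_beta_def numeral_eq_Suc monom_altdef)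

lemma bdf_alpha_4:
  "bdf_alpha 4 0 = 3/25" "bdf_alpha 4 1 = -16/25" "bdf_alpha 4 2 = 36/25"
  "bdf_alpha 4 3 = -48/25" "bdf_alpha 4 4 = 1"
  by (simp_all add: bdf_alpha_def bdf_beta_def numeral_eq_Suc monom_altdef)

section \<open>Multiplier estimate\<close>

text \<open>Dahlquist's G-stability in the form needed here. Only the values \<open>x 0, \<dots>, x (q - 1)\<close> are meant
  to enter \<open>G x\<close>, so that \<open>G\<close> of the shifted sequence is the form at the next time level. The
  summand with \<open>\<delta>\<close> is the numerical dissipation that later absorbs the explicit flux. It
  involves differences only: constant sequences annihilate the left factor of the right-hand side.\<close>
definition G_stable ::
  "nat \<Rightarrow> (nat \<Rightarrow> real) \<Rightarrow> ((nat \<Rightarrow> real) \<Rightarrow> real) \<Rightarrow> real \<Rightarrow> real \<Rightarrow> real \<Rightarrow> bool" where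
  "G_stable q \<alpha> G g M \<delta> \<longleftrightarrow> 0 < g \<and> 0 < \<delta> \<and>
     (\<forall>x. g * (\<Sum>i<q. (x i)\<^sup>2) \<le> G x \<and> G x \<le> M * (\<Sum>i<q. (x i)\<^sup>2) \<and>
       G (\<lambda>i. x (Suc i)) - G x + \<delta> * (\<Sum>i<q. (x (Suc i) - x i)\<^sup>2)
         \<le> (\<Sum>i=0..q. \<alpha> i * x i) * (x q - x (q - 1) / 2))"

lemma expand_sums:
  fixes f :: "nat \<Rightarrow> real"
  shows "(\<Sum>i<2. f i) = f 0 + f 1" "(\<Sum>i<3. f i) = f 0 + f 1 + f 2"
    "(\<Sum>i<4. f i) = f 0 + f 1 + f 2 + f 3"
    "(\<Sum>i=0..2. f i) = f 0 + f 1 + f 2" "(\<Sum>i=0..3. f i) = f 0 + f 1 + f 2 + f 3"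
    "(\<Sum>i=0..4. f i) = f 0 + f 1 + f 2 + f 3 + f 4"
  by (simp_all add: numeral_eq_Suc atLeast0_atMost_Suc lessThan_Suc)

lemma bdf1_G_stable: "G_stable 1 (bdf_alpha 1) (\<lambda>x. (x 0)\<^sup>2 / 4) (1/4) 1 (3/4)"
  by (simp add: G_stable_def bdf_alpha_1[simplified] field_simps power2_eq_square)

text \<open>
  On the unit circle, \<open>\<Re> (\<alpha>(\<zeta>) \<zeta>\<^bsup>-q\<^esup> (1 - \<zeta> / 2)) \<ge> c \<bar>\<zeta> - 1\<bar>\<^sup>2\<close> holds for \<open>q \<le> 4\<close> with
  \<open>c > 0.11\<close>, and by the Kalman--Yakubovich--Popov lemma such an inequality yields a
  suitable \<open>G\<close>. The residual form in the \<open>q + 1\<close> values has to vanish on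
  constant sequences, which prescribes the row sums of the matrix of \<open>G\<close>. Its off-diagonal entries
  below are chosen in the interior of the remaining feasible set, with small denominators.
  Completing squares successively (an \<open>L D L\<^sup>T\<close> factorization), once in the values and once
  in their differences, then shows both positivity statements.
\<close>
lemma bdf2_G_stable: "\<exists>G. G_stable 2 (bdf_alpha 2) G (1/24) 2 (1/12)"
proof -
  define P where "P x y = 1/4 * x\<^sup>2 + 7/12 * y\<^sup>2 - 2/3 * x * y" for x y :: real
  have squares: "P x y = 1/24 * (x\<^sup>2 + y\<^sup>2) + 5/24 * (x - 8/5 * y)\<^sup>2 + 1/120 * y\<^sup>2" for x y
    by (simp add: P_def power2_eq_square field_simps)
  have lower: "1/24 * (x\<^sup>2 + y\<^sup>2) \<le> P x y" for x y
    unfolding squares by (intro add_increasing2) simp_all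
  have "2 * (x\<^sup>2 + y\<^sup>2) = P x y + 1/3 * (x + y)\<^sup>2 + 17/12 * x\<^sup>2 + 13/12 * y\<^sup>2" for x y
    by (simp add: P_def power2_eq_square field_simps)
  then have upper: "P x y \<le> 2 * (x\<^sup>2 + y\<^sup>2)" for x y
    by simp
  have "(1/3 * x - 4/3 * y + z) * (z - y / 2) =
      P y z - P x y + 1/12 * ((y - x)\<^sup>2 + (z - y)\<^sup>2)
      + 1/6 * ((y - x) - (z - y))\<^sup>2 + 1/6 * (z - y)\<^sup>2" for x y z
    by (simp add: P_def power2_eq_square field_simps)
  then have step: "P y z - P x y + 1/12 * ((y - x)\<^sup>2 + (z - y)\<^sup>2)
      \<le> (1/3 * x - 4/3 * y + z) * (z - y / 2)" for x y z
    by simp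
  have "G_stable 2 (bdf_alpha 2) (\<lambda>x. P (x 0) (x 1)) (1/24) 2 (1/12)"
    unfolding G_stable_def expand_sums bdf_alpha_2
  proof (intro conjI allI)
    fix x :: "nat \<Rightarrow> real"
    show "1/24 * ((x 0)\<^sup>2 + (x 1)\<^sup>2) \<le> P (x 0) (x 1)"
      by (rule lower)
    show "P (x 0) (x 1) \<le> 2 * ((x 0)\<^sup>2 + (x 1)\<^sup>2)"
      by (rule upper)
  qed (use step in \<open>simp_all add: eval_nat_numeral\<close>)
  then show ?thesis
    by (intro exI)
qed

lemma bdf3_G_stable: "\<exists>G. G_stable 3 (bdf_alpha 3) G (1/44) 3 (1/44)"
proof -
  define P where "P x y z = 5/22 * x\<^sup>2 + 45/44 * y\<^sup>2 + 39/44 * z\<^sup>2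
    - 8/11 * x * y + 4/11 * x * z - 18/11 * y * z" for x y z :: real
  have squares: "P x y z = 1/44 * (x\<^sup>2 + y\<^sup>2 + z\<^sup>2)
      + 9/44 * (x - 16/9 * y + 8/9 * z)\<^sup>2 + 35/99 * (y - 7/5 * z)\<^sup>2 + 1/110 * z\<^sup>2" for x y z
    by (simp add: P_def power2_eq_square field_simps)
  have lower: "1/44 * (x\<^sup>2 + y\<^sup>2 + z\<^sup>2) \<le> P x y z" for x y z
    unfolding squares by (intro add_increasing2) simp_all
  have "3 * (x\<^sup>2 + y\<^sup>2 + z\<^sup>2) = P x y z
      + 4/11 * (x + y)\<^sup>2 + 2/11 * (x - z)\<^sup>2 + 9/11 * (y + z)\<^sup>2
      + 49/22 * x\<^sup>2 + 35/44 * y\<^sup>2 + 49/44 * z\<^sup>2" for x y z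
    by (simp add: P_def power2_eq_square field_simps)
  then have upper: "P x y z \<le> 3 * (x\<^sup>2 + y\<^sup>2 + z\<^sup>2)" for x y z
    by simp
  have "(-2/11 * x + 9/11 * y - 18/11 * z + u) * (u - z / 2) =
      P y z u - P x y z + 1/44 * ((y - x)\<^sup>2 + (z - y)\<^sup>2 + (u - z)\<^sup>2)
      + 9/44 * ((y - x) - 2/3 * (z - y) + 4/9 * (u - z))\<^sup>2
      + 2/11 * ((z - y) - 5/12 * (u - z))\<^sup>2 + 5/264 * (u - z)\<^sup>2" for x y z u
    by (simp add: P_def power2_eq_square field_simps)
  then have step: "P y z u - P x y z + 1/44 * ((y - x)\<^sup>2 + (z - y)\<^sup>2 + (u - z)\<^sup>2)
      \<le> (-2/11 * x + 9/11 * y - 18/11 * z + u) * (u - z / 2)" for x y z u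
    by simp
  have "G_stable 3 (bdf_alpha 3) (\<lambda>x. P (x 0) (x 1) (x 2)) (1/44) 3 (1/44)"
    unfolding G_stable_def expand_sums bdf_alpha_3
  proof (intro conjI allI)
    fix x :: "nat \<Rightarrow> real"
    show "1/44 * ((x 0)\<^sup>2 + (x 1)\<^sup>2 + (x 2)\<^sup>2) \<le> P (x 0) (x 1) (x 2)"
      by (rule lower)
    show "P (x 0) (x 1) (x 2) \<le> 3 * ((x 0)\<^sup>2 + (x 1)\<^sup>2 + (x 2)\<^sup>2)"
      by (rule upper)
  qed (use step in \<open>simp_all add: eval_nat_numeral\<close>)
  then show ?thesis
    by (intro exI)
qed

lemma bdf4_G_stable: "\<exists>G. G_stable 4 (bdf_alpha 4) G (1/100) 4 (1/100)"
proof -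
  define P where "P x y z u = 17/100 * x\<^sup>2 + 81/100 * y\<^sup>2 + 149/100 * z\<^sup>2 + 93/100 * u\<^sup>2
    - 16/25 * x * y + 16/25 * x * z - 2/5 * x * u
    - 48/25 * y * z + 6/5 * y * u - 54/25 * z * u" for x y z u :: real
  have squares: "P x y z u = 1/100 * (x\<^sup>2 + y\<^sup>2 + z\<^sup>2 + u\<^sup>2)
      + 4/25 * (x - 2 * y + 2 * z - 5/4 * u)\<^sup>2 + 4/25 * (y - 2 * z + 5/4 * u)\<^sup>2
      + 1/5 * (z - 7/5 * u)\<^sup>2 + 7/250 * u\<^sup>2" for x y z u
    by (simp add: P_def power2_eq_square field_simps)
  have lower: "1/100 * (x\<^sup>2 + y\<^sup>2 + z\<^sup>2 + u\<^sup>2) \<le> P x y z u" for x y z u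
    unfolding squares by (intro add_increasing2) simp_all
  have "4 * (x\<^sup>2 + y\<^sup>2 + z\<^sup>2 + u\<^sup>2) = P x y z u
      + 8/25 * (x + y)\<^sup>2 + 8/25 * (x - z)\<^sup>2 + 1/5 * (x + u)\<^sup>2
      + 24/25 * (y + z)\<^sup>2 + 3/5 * (y - u)\<^sup>2 + 27/25 * (z + u)\<^sup>2
      + 299/100 * x\<^sup>2 + 131/100 * y\<^sup>2 + 3/20 * z\<^sup>2 + 119/100 * u\<^sup>2" for x y z u
    by (simp add: P_def power2_eq_square field_simps)
  then have upper: "P x y z u \<le> 4 * (x\<^sup>2 + y\<^sup>2 + z\<^sup>2 + u\<^sup>2)" for x y z u
    by simp
  have "(3/25 * x - 16/25 * y + 36/25 * z - 48/25 * u + v) * (v - u / 2) =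
      P y z u v - P x y z u + 1/100 * ((y - x)\<^sup>2 + (z - y)\<^sup>2 + (u - z)\<^sup>2 + (v - u)\<^sup>2)
      + 4/25 * ((y - x) - 15/16 * (z - y) + 17/16 * (u - z) - 3/8 * (v - u))\<^sup>2
      + 31/1600 * ((z - y) + 15/31 * (u - z) + 6/31 * (v - u))\<^sup>2
      + 23/1550 * ((u - z) + 3/23 * (v - u))\<^sup>2 + 21/575 * (v - u)\<^sup>2" for x y z u v
    by (simp add: P_def power2_eq_square field_simps)
  then have step: "P y z u v - P x y z u
      + 1/100 * ((y - x)\<^sup>2 + (z - y)\<^sup>2 + (u - z)\<^sup>2 + (v - u)\<^sup>2)
      \<le> (3/25 * x - 16/25 * y + 36/25 * z - 48/25 * u + v) * (v - u / 2)" for x y z u v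
    by simp
  have "G_stable 4 (bdf_alpha 4) (\<lambda>x. P (x 0) (x 1) (x 2) (x 3)) (1/100) 4 (1/100)"
    unfolding G_stable_def expand_sums bdf_alpha_4
  proof (intro conjI allI)
    fix x :: "nat \<Rightarrow> real"
    show "1/100 * ((x 0)\<^sup>2 + (x 1)\<^sup>2 + (x 2)\<^sup>2 + (x 3)\<^sup>2) \<le> P (x 0) (x 1) (x 2) (x 3)"
      by (rule lower)
    show "P (x 0) (x 1) (x 2) (x 3) \<le> 4 * ((x 0)\<^sup>2 + (x 1)\<^sup>2 + (x 2)\<^sup>2 + (x 3)\<^sup>2)"
      by (rule upper)
  qed (use step in \<open>simp_all add: eval_nat_numeral\<close>)
  then show ?thesis
    by (intro exI)
qed

lemma bdf_G_stable:
  assumes "q \<in> {1, 2, 3, 4}"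
  shows "\<exists>G g M \<delta>. G_stable q (bdf_alpha q) G g M \<delta>"
  using assms bdf1_G_stable bdf2_G_stable bdf3_G_stable bdf4_G_stable by blast

section \<open>Energy estimate for one Fourier mode\<close>

text \<open>A real quadratic form acts on complex sequences through real and imaginary parts, the
  Hermitian extension of \<open>G\<close>.\<close>
definition G_energy :: "((nat \<Rightarrow> real) \<Rightarrow> real) \<Rightarrow> (nat \<Rightarrow> complex) \<Rightarrow> nat \<Rightarrow> real" where
  "G_energy G z n = G (\<lambda>i. Re (z (n + i))) + G (\<lambda>i. Im (z (n + i)))"

lemma G_energy_bounds:
  assumes "G_stable q \<alpha> G g M \<delta>"
  shows "g * (\<Sum>i<q. (cmod (z (n + i)))\<^sup>2) \<le> G_energy G z n"
    and "G_energy G z n \<le> M * (\<Sum>i<q. (cmod (z (n + i)))\<^sup>2)"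
proof -
  have "g * (\<Sum>i<q. (x i)\<^sup>2) \<le> G x" "G x \<le> M * (\<Sum>i<q. (x i)\<^sup>2)" for x
    using assms by (auto simp: G_stable_def)
  from this[of "\<lambda>i. Re (z (n + i))"] this[of "\<lambda>i. Im (z (n + i))"]
  show "g * (\<Sum>i<q. (cmod (z (n + i)))\<^sup>2) \<le> G_energy G z n"
    and "G_energy G z n \<le> M * (\<Sum>i<q. (cmod (z (n + i)))\<^sup>2)"
    by (auto simp: G_energy_def cmod_power2 sum.distrib algebra_simps)
qed

lemma G_energy_step:
  assumes "G_stable q \<alpha> G g M \<delta>"
  shows "G_energy G z (Suc n) - G_energy G z n + \<delta> * (\<Sum>i<q. (cmod (z (n + Suc i) - z (n + i)))\<^sup>2)
    \<le> Re ((\<Sum>i=0..q. \<alpha> i *\<^sub>R z (n + i)) * cnj (z (n + q) - z (n + (q - 1)) / 2))"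
proof -
  have "G (\<lambda>i. x (Suc i)) - G x + \<delta> * (\<Sum>i<q. (x (Suc i) - x i)\<^sup>2)
      \<le> (\<Sum>i=0..q. \<alpha> i * x i) * (x q - x (q - 1) / 2)" for x
    using assms by (auto simp: G_stable_def)
  from add_mono[OF this[of "\<lambda>i. Re (z (n + i))"] this[of "\<lambda>i. Im (z (n + i))"]]
  moreover have "Re (a * cnj (x - y / 2))
      = Re a * (Re x - Re y / 2) + Im a * (Im x - Im y / 2)" for a x y
    by (simp add: algebra_simps)
  ultimately show ?thesis
    by (simp add: G_energy_def cmod_power2 sum.distrib distrib_left del: times_complex.sel)
qed

text \<open>The parts of the flux proportional to \<open>c\<close> drop out: in the inner product with weight
  \<open>(1 - b\<^sup>2, 1)\<close> the flux matrix is symmetric, hence \<open>\<i> \<xi>\<close> times it is skew-Hermitian. Only the flux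
  of \<open>(a\<^sub>1, a\<^sub>2)\<close> remains, and the entries of the symmetrized matrix are at most \<open>1\<close> in modulus.\<close>
lemma flux_skew_estimate:
  fixes b \<xi> c :: real and a\<^sub>1 a\<^sub>2 m\<^sub>1 m\<^sub>2 :: complex
  assumes "\<bar>b\<bar> < 1"
  shows "(1 - b\<^sup>2) * Re (- (\<i> * \<xi> * (b *\<^sub>R (a\<^sub>1 + c *\<^sub>R m\<^sub>1) + (a\<^sub>2 + c *\<^sub>R m\<^sub>2))) * cnj m\<^sub>1)
      + Re (- (\<i> * \<xi> * ((1 - b\<^sup>2) *\<^sub>R (a\<^sub>1 + c *\<^sub>R m\<^sub>1) - b *\<^sub>R (a\<^sub>2 + c *\<^sub>R m\<^sub>2))) * cnj m\<^sub>2)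
    \<le> \<bar>\<xi>\<bar> * ((cmod a\<^sub>1 + cmod a\<^sub>2) * (cmod m\<^sub>1 + cmod m\<^sub>2))"
proof -
  define s where "s = 1 - b\<^sup>2"
  have s: "0 \<le> s" "s \<le> 1"
    using assms by (auto simp: s_def abs_square_le_1 less_imp_le)
  define h where "h = (s * b) *\<^sub>R (a\<^sub>1 * cnj m\<^sub>1) + s *\<^sub>R (a\<^sub>2 * cnj m\<^sub>1)
    + s *\<^sub>R (a\<^sub>1 * cnj m\<^sub>2) - b *\<^sub>R (a\<^sub>2 * cnj m\<^sub>2)"
  have "cmod h \<le> (s * \<bar>b\<bar>) * (cmod a\<^sub>1 * cmod m\<^sub>1) + s * (cmod a\<^sub>2 * cmod m\<^sub>1)
      + s * (cmod a\<^sub>1 * cmod m\<^sub>2) + \<bar>b\<bar> * (cmod a\<^sub>2 * cmod m\<^sub>2)"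
    unfolding h_def using s
    by (intro order.trans[OF norm_triangle_ineq4] order.trans[OF norm_triangle_ineq] add_mono)
      (simp_all add: norm_mult abs_mult)
  also have "\<dots> \<le> 1 * (cmod a\<^sub>1 * cmod m\<^sub>1) + 1 * (cmod a\<^sub>2 * cmod m\<^sub>1)
      + 1 * (cmod a\<^sub>1 * cmod m\<^sub>2) + 1 * (cmod a\<^sub>2 * cmod m\<^sub>2)"
    using s assms by (intro add_mono mult_right_mono mult_le_one) auto
  also have "\<dots> = (cmod a\<^sub>1 + cmod a\<^sub>2) * (cmod m\<^sub>1 + cmod m\<^sub>2)"
    by (simp add: algebra_simps)
  finally have h: "cmod h \<le> (cmod a\<^sub>1 + cmod a\<^sub>2) * (cmod m\<^sub>1 + cmod m\<^sub>2)" .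
  have "s * Re (- (\<i> * \<xi> * (b *\<^sub>R (a\<^sub>1 + c *\<^sub>R m\<^sub>1) + (a\<^sub>2 + c *\<^sub>R m\<^sub>2))) * cnj m\<^sub>1)
      + Re (- (\<i> * \<xi> * (s *\<^sub>R (a\<^sub>1 + c *\<^sub>R m\<^sub>1) - b *\<^sub>R (a\<^sub>2 + c *\<^sub>R m\<^sub>2))) * cnj m\<^sub>2)
      = Re (- (\<i> * \<xi> * h))"
    by (simp add: h_def algebra_simps)
  also have "\<dots> \<le> cmod (- (\<i> * \<xi> * h))"
    by (rule complex_Re_le_cmod)
  also have "\<dots> = \<bar>\<xi>\<bar> * cmod h"
    by (simp add: norm_mult)
  also have "\<dots> \<le> \<bar>\<xi>\<bar> * ((cmod a\<^sub>1 + cmod a\<^sub>2) * (cmod m\<^sub>1 + cmod m\<^sub>2))"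
    using h by (rule mult_left_mono) simp
  finally show ?thesis
    by (simp only: s_def)
qed

lemma abs_coeff_sum_le:
  fixes f :: "nat \<Rightarrow> complex"
  assumes "finite I" and "\<And>i. i \<in> I \<Longrightarrow> cmod (f i) \<le> d"
  shows "cmod (\<Sum>i\<in>I. a i *\<^sub>R f i) \<le> (\<Sum>i\<in>I. \<bar>a i\<bar>) * d"
  unfolding sum_distrib_right using assms
  by (intro sum_norm_le) (simp add: mult_left_mono)

text \<open>Both \<open>\<Sum>i<q. \<gamma> i z\<^sub>n\<^sub>+\<^sub>i\<close> and \<open>2 \<beta> (z\<^sub>n\<^sub>+\<^sub>q - z\<^sub>n\<^sub>+\<^sub>q\<^sub>-\<^sub>1 / 2)\<close> have coefficient sum \<open>\<beta>\<close>, so their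
  difference is a combination of first differences of \<open>z\<close>. The subtracted vector is a multiple of the
  multiplier, so that the skew-symmetry of the flux removes its contribution.\<close>
lemma extrapolation_defect:
  fixes z :: "nat \<Rightarrow> complex"
  assumes "0 < q" and "(\<Sum>i<q. \<gamma> i) = \<beta>"
  shows "(cmod ((\<Sum>i<q. \<gamma> i *\<^sub>R z (n + i)) - (2 * \<beta>) *\<^sub>R (z (n + q) - z (n + (q - 1)) / 2)))\<^sup>2
    \<le> ((\<Sum>i<q. \<bar>\<gamma> i\<bar>) + \<bar>\<beta>\<bar>)\<^sup>2 * (q * (\<Sum>i<q. (cmod (z (n + Suc i) - z (n + i)))\<^sup>2))"
proof -
  define d where "d = (\<Sum>i<q. cmod (z (n + Suc i) - z (n + i)))"
  have near: "cmod (z (n + i) - z (n + q)) \<le> d" if "i < q" for i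
  proof -
    have "z (n + q) - z (n + i) = (\<Sum>j=i..<q. z (n + Suc j) - z (n + j))"
      using that by (subst sum_Suc_diff') auto
    then have "cmod (z (n + i) - z (n + q)) = cmod (\<Sum>j=i..<q. z (n + Suc j) - z (n + j))"
      by (simp only: norm_minus_commute[of "z (n + i)"])
    also have "\<dots> \<le> (\<Sum>j=i..<q. cmod (z (n + Suc j) - z (n + j)))"
      by (rule norm_sum)
    also have "\<dots> \<le> d"
      unfolding d_def by (intro sum_mono2) auto
    finally show ?thesis .
  qed
  have "(\<Sum>i<q. \<gamma> i *\<^sub>R z (n + i)) - (2 * \<beta>) *\<^sub>R (z (n + q) - z (n + (q - 1)) / 2)
      = (\<Sum>i<q. \<gamma> i *\<^sub>R (z (n + i) - z (n + q))) + \<beta> *\<^sub>R (z (n + (q - 1)) - z (n + q))"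
    by (simp add: scaleR_diff_right sum_subtractf scaleR_left.sum[symmetric] assms(2))
      (simp add: scaleR_conv_of_real algebra_simps)
  also have "cmod \<dots> \<le> (\<Sum>i<q. \<bar>\<gamma> i\<bar>) * d + \<bar>\<beta>\<bar> * d"
    using near near[of "q - 1"] assms(1)
    by (intro order.trans[OF norm_triangle_ineq] add_mono abs_coeff_sum_le)
      (auto intro!: mult_left_mono)
  finally have "(cmod ((\<Sum>i<q. \<gamma> i *\<^sub>R z (n + i)) - (2 * \<beta>) *\<^sub>R (z (n + q) - z (n + (q - 1)) / 2)))\<^sup>2
      \<le> (((\<Sum>i<q. \<bar>\<gamma> i\<bar>) + \<bar>\<beta>\<bar>) * d)\<^sup>2"
    by (intro power_mono) (simp_all add: distrib_right)
  also have "\<dots> = ((\<Sum>i<q. \<bar>\<gamma> i\<bar>) + \<bar>\<beta>\<bar>)\<^sup>2 * d\<^sup>2"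
    by (simp add: power_mult_distrib)
  also have "d\<^sup>2 \<le> q * (\<Sum>i<q. (cmod (z (n + Suc i) - z (n + i)))\<^sup>2)"
    unfolding d_def
    using sum_squared_le_sum_of_squares[where I = "{..<q}" and f = "\<lambda>i. cmod (z (n + Suc i) - z (n + i))"]
    by (simp add: mult.commute)
  finally show ?thesis
    by (simp add: mult_left_mono)
qed

text \<open>The scheme for the Fourier coefficients at wave number \<open>k\<close>, with \<open>\<xi> = k \<Delta>t\<close> and
  \<open>\<kappa> = \<beta> \<Delta>t / \<epsilon>\<close>.\<close>
definition mode_scheme ::
  "nat \<Rightarrow> (nat \<Rightarrow> real) \<Rightarrow> (nat \<Rightarrow> real) \<Rightarrow> real \<Rightarrow> real \<Rightarrow> real
    \<Rightarrow> (nat \<Rightarrow> complex) \<Rightarrow> (nat \<Rightarrow> complex) \<Rightarrow> bool" where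
  "mode_scheme q \<alpha> \<gamma> b \<kappa> \<xi> u w \<longleftrightarrow>
     (\<forall>n. (\<Sum>i=0..q. \<alpha> i *\<^sub>R u (n + i))
            = - (\<i> * \<xi> * (b *\<^sub>R (\<Sum>i<q. \<gamma> i *\<^sub>R u (n + i)) + (\<Sum>i<q. \<gamma> i *\<^sub>R w (n + i)))) \<and>
          (\<Sum>i=0..q. \<alpha> i *\<^sub>R w (n + i))
            = - (\<i> * \<xi> * ((1 - b\<^sup>2) *\<^sub>R (\<Sum>i<q. \<gamma> i *\<^sub>R u (n + i))
                - b *\<^sub>R (\<Sum>i<q. \<gamma> i *\<^sub>R w (n + i)))) - \<kappa> *\<^sub>R w (n + q))"

text \<open>Crude but uniform in \<open>\<kappa>\<close>: solving the second equation for \<open>w\<^sub>n\<^sub>+\<^sub>q\<close> divides by \<open>1 + \<kappa> \<ge> 1\<close>.\<close>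
lemma new_level_bound:
  fixes u w :: "nat \<Rightarrow> complex"
  assumes scheme: "mode_scheme q \<alpha> \<gamma> b \<kappa> \<xi> u w" and "\<alpha> q = 1"
    and "\<bar>b\<bar> < 1" and "0 \<le> \<kappa>"
  shows "cmod (u (n + q)) + cmod (w (n + q))
    \<le> 2 * ((\<Sum>i<q. \<bar>\<alpha> i\<bar>) + 2 * \<bar>\<xi>\<bar> * (\<Sum>i<q. \<bar>\<gamma> i\<bar>))
        * (\<Sum>i<q. cmod (u (n + i)) + cmod (w (n + i)))"
proof -
  define S where "S = (\<Sum>i<q. cmod (u (n + i)) + cmod (w (n + i)))"
  define B where "B = (\<Sum>i<q. \<bar>\<gamma> i\<bar>) * S"
  have S: "cmod (u (n + i)) \<le> S" "cmod (w (n + i)) \<le> S" if "i < q" for i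
    using that member_le_sum[of i "{..<q}" "\<lambda>i. cmod (u (n + i)) + cmod (w (n + i))"]
    by (auto simp: S_def intro: order.trans[rotated])
  have \<gamma>: "cmod (\<Sum>i<q. \<gamma> i *\<^sub>R u (n + i)) \<le> B" "cmod (\<Sum>i<q. \<gamma> i *\<^sub>R w (n + i)) \<le> B"
    unfolding B_def by (intro abs_coeff_sum_le; use S in auto)+
  have \<alpha>: "cmod (\<Sum>i<q. \<alpha> i *\<^sub>R u (n + i)) \<le> (\<Sum>i<q. \<bar>\<alpha> i\<bar>) * S"
    "cmod (\<Sum>i<q. \<alpha> i *\<^sub>R w (n + i)) \<le> (\<Sum>i<q. \<bar>\<alpha> i\<bar>) * S"
    by (intro abs_coeff_sum_le; use S in auto)+
  have split: "(\<Sum>i=0..q. \<alpha> i *\<^sub>R z (n + i)) = (\<Sum>i<q. \<alpha> i *\<^sub>R z (n + i)) + z (n + q)"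
    for z :: "nat \<Rightarrow> complex"
    by (simp add: atLeast0AtMost lessThan_Suc_atMost[symmetric] \<open>\<alpha> q = 1\<close>)
  have flux: "cmod (\<i> * \<xi> * (r *\<^sub>R x + t *\<^sub>R y)) \<le> 2 * \<bar>\<xi>\<bar> * B"
    if "\<bar>r\<bar> \<le> 1" "\<bar>t\<bar> \<le> 1" "cmod x \<le> B" "cmod y \<le> B" for r t :: real and x y :: complex
  proof -
    have "cmod (r *\<^sub>R x + t *\<^sub>R y) \<le> 1 * B + 1 * B"
      by (intro order.trans[OF norm_triangle_ineq] add_mono)
        (use that in \<open>simp_all only: norm_scaleR mult_mono norm_ge_zero zero_le_one\<close>)
    then have "\<bar>\<xi>\<bar> * cmod (r *\<^sub>R x + t *\<^sub>R y) \<le> \<bar>\<xi>\<bar> * (1 * B + 1 * B)"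
      by (rule mult_left_mono) simp
    then show ?thesis
      by (simp add: norm_mult)
  qed
  have b: "\<bar>b\<bar> \<le> 1" "\<bar>1 - b\<^sup>2\<bar> \<le> 1"
    using \<open>\<bar>b\<bar> < 1\<close> abs_square_less_1[of b] zero_le_power2[of b] by linarith+
  have bound: "cmod v \<le> 2 * \<bar>\<xi>\<bar> * B + (\<Sum>i<q. \<bar>\<alpha> i\<bar>) * S"
    if "v = - (\<i> * \<xi> * (r *\<^sub>R (\<Sum>i<q. \<gamma> i *\<^sub>R u (n + i)) + t *\<^sub>R (\<Sum>i<q. \<gamma> i *\<^sub>R w (n + i)))) - a"
      "\<bar>r\<bar> \<le> 1" "\<bar>t\<bar> \<le> 1" "cmod a \<le> (\<Sum>i<q. \<bar>\<alpha> i\<bar>) * S" for v a :: complex and r t :: real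
    unfolding that(1)
    by (intro order.trans[OF norm_triangle_ineq4] add_mono)
      (use that(2-) flux \<gamma> in \<open>simp_all only: norm_minus_cancel\<close>)
  have u: "cmod (u (n + q)) \<le> 2 * \<bar>\<xi>\<bar> * B + (\<Sum>i<q. \<bar>\<alpha> i\<bar>) * S"
  proof (rule bound[where r = b and t = 1])
    have "(\<Sum>i<q. \<alpha> i *\<^sub>R u (n + i)) + u (n + q)
        = - (\<i> * \<xi> * (b *\<^sub>R (\<Sum>i<q. \<gamma> i *\<^sub>R u (n + i)) + (\<Sum>i<q. \<gamma> i *\<^sub>R w (n + i))))"
      using scheme unfolding mode_scheme_def split[of u, symmetric] by blast
    then show "u (n + q) = - (\<i> * \<xi> * (b *\<^sub>R (\<Sum>i<q. \<gamma> i *\<^sub>R u (n + i)) + 1 *\<^sub>R (\<Sum>i<q. \<gamma> i *\<^sub>R w (n + i))))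
        - (\<Sum>i<q. \<alpha> i *\<^sub>R u (n + i))"
      by (simp only: scaleR_one eq_diff_eq add.commute)
  qed (use b \<alpha> in auto)
  have "cmod ((1 + \<kappa>) *\<^sub>R w (n + q)) \<le> 2 * \<bar>\<xi>\<bar> * B + (\<Sum>i<q. \<bar>\<alpha> i\<bar>) * S"
  proof (rule bound[where r = "1 - b\<^sup>2" and t = "- b"])
    have "(\<Sum>i<q. \<alpha> i *\<^sub>R w (n + i)) + w (n + q)
        = - (\<i> * \<xi> * ((1 - b\<^sup>2) *\<^sub>R (\<Sum>i<q. \<gamma> i *\<^sub>R u (n + i))
            - b *\<^sub>R (\<Sum>i<q. \<gamma> i *\<^sub>R w (n + i)))) - \<kappa> *\<^sub>R w (n + q)"
      using scheme unfolding mode_scheme_def split[of w, symmetric] by blast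
    then show "(1 + \<kappa>) *\<^sub>R w (n + q) = - (\<i> * \<xi> * ((1 - b\<^sup>2) *\<^sub>R (\<Sum>i<q. \<gamma> i *\<^sub>R u (n + i))
        + (- b) *\<^sub>R (\<Sum>i<q. \<gamma> i *\<^sub>R w (n + i)))) - (\<Sum>i<q. \<alpha> i *\<^sub>R w (n + i))"
      by (simp only: scaleR_add_left scaleR_one scaleR_minus_left eq_diff_eq)
        (simp only: ac_simps diff_conv_add_uminus)
  qed (use b \<alpha> in auto)
  then have "(1 + \<kappa>) * cmod (w (n + q)) \<le> 2 * \<bar>\<xi>\<bar> * B + (\<Sum>i<q. \<bar>\<alpha> i\<bar>) * S"
    using \<open>0 \<le> \<kappa>\<close> by simp
  moreover have "0 \<le> \<kappa> * cmod (w (n + q))"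
    using \<open>0 \<le> \<kappa>\<close> by simp
  ultimately have "cmod (w (n + q)) \<le> 2 * \<bar>\<xi>\<bar> * B + (\<Sum>i<q. \<bar>\<alpha> i\<bar>) * S"
    by (simp add: distrib_right)
  with u show ?thesis
    unfolding S_def[symmetric] B_def by (simp add: algebra_simps)
qed

text \<open>The weight \<open>1 - b\<^sup>2\<close> symmetrizes the flux; the last summand compensates for the part of the
  multiplier at the older time level in the relaxation term.\<close>
definition mode_energy ::
  "((nat \<Rightarrow> real) \<Rightarrow> real) \<Rightarrow> nat \<Rightarrow> real \<Rightarrow> real
    \<Rightarrow> (nat \<Rightarrow> complex) \<Rightarrow> (nat \<Rightarrow> complex) \<Rightarrow> nat \<Rightarrow> real" where
  "mode_energy G q b \<kappa> u w n = (1 - b\<^sup>2) * G_energy G u n + G_energy G w n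
     + \<kappa> / 4 * (cmod (w (n + (q - 1))))\<^sup>2"

text \<open>The difference of the two sides is \<open>\<bar>y\<bar>\<^sup>2 / 2 + \<bar>y - x\<bar>\<^sup>2 / 4\<close>.\<close>
lemma relaxation_dissipates:
  "((cmod y)\<^sup>2 - (cmod x)\<^sup>2) / 4 \<le> Re (y * cnj (y - x / 2))"
proof -
  have eq: "Re (y * cnj (y - x / 2))
      = ((cmod y)\<^sup>2 - (cmod x)\<^sup>2) / 4 + (2 * (cmod y)\<^sup>2 + (cmod (y - x))\<^sup>2) / 4"
    unfolding cmod_power2 by (simp add: power2_eq_square field_simps)
  show ?thesis
    unfolding eq by simp
qed

lemma sum_norm_pair_le_mode_energy:
  assumes "G_stable q \<alpha> G g M \<delta>" and "\<bar>b\<bar> < 1" and "0 \<le> \<kappa>"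
  shows "(1 - b\<^sup>2) * g * (\<Sum>i<q. (cmod (u (n + i)))\<^sup>2 + (cmod (w (n + i)))\<^sup>2)
    \<le> mode_energy G q b \<kappa> u w n"
proof -
  define s where "s = 1 - b\<^sup>2"
  have s: "0 \<le> s" "s \<le> 1"
    using assms(2) by (auto simp: s_def abs_square_le_1 less_imp_le)
  have g: "0 < g"
    using assms(1) by (simp add: G_stable_def)
  have "s * (g * (\<Sum>i<q. (cmod (u (n + i)))\<^sup>2)) \<le> s * G_energy G u n"
    using G_energy_bounds(1)[OF assms(1)] s(1) by (rule mult_left_mono)
  moreover have "s * (g * (\<Sum>i<q. (cmod (w (n + i)))\<^sup>2)) \<le> 1 * (g * (\<Sum>i<q. (cmod (w (n + i)))\<^sup>2))"
    using s(2) g by (intro mult_right_mono) (auto intro!: mult_nonneg_nonneg sum_nonneg)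
  moreover have "g * (\<Sum>i<q. (cmod (w (n + i)))\<^sup>2) \<le> G_energy G w n"
    by (rule G_energy_bounds(1)[OF assms(1)])
  moreover have "0 \<le> \<kappa> / 4 * (cmod (w (n + (q - 1))))\<^sup>2"
    using assms(3) by simp
  ultimately show ?thesis
    unfolding mode_energy_def s_def[symmetric] sum.distrib by (simp add: algebra_simps)
qed

text \<open>
  Adding the two tested equations, the first with weight \<open>s = 1 - b\<^sup>2\<close>, leaves the flux term
  \<open>\<bar>\<xi>\<bar> (\<bar>a u\<bar> + \<bar>a w\<bar>) (\<bar>m u\<bar> + \<bar>m w\<bar>)\<close>, where \<open>a\<close> is a combination of first differences and \<open>m\<close> the
  multiplier. Young's inequality is weighted such that the part with \<open>a\<close> is at most the available
  dissipation \<open>s \<delta> (D u + D w)\<close>; the other part is \<open>\<xi>\<^sup>2 \<bar>m\<bar>\<^sup>2\<close> up to constants and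
  hence bounded by the energy at the \<^emph>\<open>old\<close> time level. The bound \<open>c\<close> on \<open>\<bar>\<xi>\<bar>\<close> enters only through
  the size of the new level.
\<close>
lemma mode_energy_growth:
  fixes b c :: real
  assumes G: "G_stable q \<alpha> G g M \<delta>" and q: "0 < q" and "\<alpha> q = 1"
    and \<gamma>: "(\<Sum>i<q. \<gamma> i) = \<beta>" and b: "\<bar>b\<bar> < 1" and "0 \<le> c"
  shows "\<exists>L\<ge>0. \<forall>\<kappa> \<xi> u w n. 0 \<le> \<kappa> \<longrightarrow> \<bar>\<xi>\<bar> \<le> c \<longrightarrow> mode_scheme q \<alpha> \<gamma> b \<kappa> \<xi> u w \<longrightarrow>
    mode_energy G q b \<kappa> u w (Suc n) \<le> (1 + L * \<xi>\<^sup>2) * mode_energy G q b \<kappa> u w n"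
proof -
  define s where "s = 1 - b\<^sup>2"
  have s: "0 < s" "s \<le> 1"
    using b by (auto simp: s_def abs_square_less_1)
  have pos: "0 < g" "0 < \<delta>"
    using G by (auto simp: G_stable_def)
  (* K bounds the extrapolation defect; the summand 1 keeps it positive, so that it may serve as a
     denominator. R is the factor by which |m u| + |m w| may exceed the sum of the moduli of the old values. *)
  define K where "K = (((\<Sum>i<q. \<bar>\<gamma> i\<bar>) + \<bar>\<beta>\<bar>)\<^sup>2 + 1) * q"
  have K: "0 < K"
    using q by (simp add: K_def add_nonneg_pos)
  define R where "R = 2 * ((\<Sum>i<q. \<bar>\<alpha> i\<bar>) + 2 * c * (\<Sum>i<q. \<bar>\<gamma> i\<bar>)) + 1"
  define L where "L = K * R\<^sup>2 * q / (s\<^sup>2 * \<delta> * g)"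
  have L: "0 \<le> L"
    using K pos s by (simp add: L_def)
  have step: "mode_energy G q b \<kappa> u w (Suc n) \<le> (1 + L * \<xi>\<^sup>2) * mode_energy G q b \<kappa> u w n"
    if \<kappa>: "0 \<le> \<kappa>" and \<xi>: "\<bar>\<xi>\<bar> \<le> c" and scheme: "mode_scheme q \<alpha> \<gamma> b \<kappa> \<xi> u w"
    for \<kappa> \<xi> u w n
  proof -
    define E where "E = mode_energy G q b \<kappa> u w n"
    define D where "D z = (\<Sum>i<q. (cmod (z (n + Suc i) - z (n + i)))\<^sup>2)" for z :: "nat \<Rightarrow> complex"
    define m where "m z = z (n + q) - z (n + (q - 1)) / 2" for z :: "nat \<Rightarrow> complex"
    define a where "a z = (\<Sum>i<q. \<gamma> i *\<^sub>R z (n + i)) - (2 * \<beta>) *\<^sub>R m z" for z :: "nat \<Rightarrow> complex"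
    have square_sum: "(x + y)\<^sup>2 \<le> 2 * (x\<^sup>2 + y\<^sup>2)" for x y :: real
      using sum_squares_bound[of x y] by (simp add: power2_sum)
    have D_nonneg: "0 \<le> D z" for z
      by (simp add: D_def sum_nonneg)
    have \<gamma>_split: "(\<Sum>i<q. \<gamma> i *\<^sub>R z (n + i)) = a z + (2 * \<beta>) *\<^sub>R m z" for z
      by (simp add: a_def)
    have a_bound: "(cmod (a z))\<^sup>2 \<le> K * D z" for z
    proof -
      have "(cmod (a z))\<^sup>2 \<le> ((\<Sum>i<q. \<bar>\<gamma> i\<bar>) + \<bar>\<beta>\<bar>)\<^sup>2 * (q * D z)"
        unfolding a_def m_def D_def by (rule extrapolation_defect[OF q \<gamma>])
      also have "\<dots> \<le> K * D z"
        unfolding K_def mult.assoc by (intro mult_right_mono) (auto simp: D_nonneg)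
      finally show ?thesis .
    qed
    have m_bound: "(cmod (m u) + cmod (m w))\<^sup>2 \<le> R\<^sup>2 * (2 * q * E / (s * g))"
    proof -
      define S where "S = (\<Sum>i<q. cmod (u (n + i)) + cmod (w (n + i)))"
      have S: "0 \<le> S"
        by (simp add: S_def sum_nonneg)
      have "cmod (u (n + (q - 1))) + cmod (w (n + (q - 1))) \<le> S"
        unfolding S_def using q
        by (intro member_le_sum[of "q - 1" "{..<q}" "\<lambda>i. cmod (u (n + i)) + cmod (w (n + i))"]) auto
      moreover have "cmod (m z) \<le> cmod (z (n + q)) + cmod (z (n + (q - 1)))" for z
        unfolding m_def
        by (rule order.trans[OF norm_triangle_ineq4]) (simp add: norm_divide)
      from add_mono[OF this[of u] this[of w]]
      have "cmod (m u) + cmod (m w) \<le> (cmod (u (n + q)) + cmod (w (n + q)))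
          + (cmod (u (n + (q - 1))) + cmod (w (n + (q - 1))))"
        by simp
      moreover have "cmod (u (n + q)) + cmod (w (n + q))
          \<le> 2 * ((\<Sum>i<q. \<bar>\<alpha> i\<bar>) + 2 * c * (\<Sum>i<q. \<bar>\<gamma> i\<bar>)) * S"
      proof -
        have "2 * \<bar>\<xi>\<bar> * (\<Sum>i<q. \<bar>\<gamma> i\<bar>) \<le> 2 * c * (\<Sum>i<q. \<bar>\<gamma> i\<bar>)"
          using \<xi> by (intro mult_right_mono) (auto simp: sum_nonneg)
        then have "2 * ((\<Sum>i<q. \<bar>\<alpha> i\<bar>) + 2 * \<bar>\<xi>\<bar> * (\<Sum>i<q. \<bar>\<gamma> i\<bar>)) * S
            \<le> 2 * ((\<Sum>i<q. \<bar>\<alpha> i\<bar>) + 2 * c * (\<Sum>i<q. \<bar>\<gamma> i\<bar>)) * S"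
          using S by (intro mult_right_mono) auto
        with new_level_bound[OF scheme \<open>\<alpha> q = 1\<close> b \<kappa>, of n] show ?thesis
          by (simp add: S_def)
      qed
      ultimately have "cmod (m u) + cmod (m w) \<le> R * S"
        by (simp add: R_def algebra_simps)
      then have "(cmod (m u) + cmod (m w))\<^sup>2 \<le> (R * S)\<^sup>2"
        by (intro power_mono) auto
      also have "\<dots> = R\<^sup>2 * S\<^sup>2"
        by (simp add: power_mult_distrib)
      also have "S\<^sup>2 \<le> q * (\<Sum>i<q. (cmod (u (n + i)) + cmod (w (n + i)))\<^sup>2)"
        unfolding S_def
    using sum_squared_le_sum_of_squares[where I = "{..<q}" and f = "\<lambda>i. cmod (u (n + i)) + cmod (w (n + i))"]
    by (simp add: mult.commute)
      also have "\<dots> \<le> q * (\<Sum>i<q. 2 * ((cmod (u (n + i)))\<^sup>2 + (cmod (w (n + i)))\<^sup>2))"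
        by (intro mult_left_mono sum_mono square_sum) auto
      also have "\<dots> = 2 * q * (\<Sum>i<q. (cmod (u (n + i)))\<^sup>2 + (cmod (w (n + i)))\<^sup>2)"
        by (simp only: sum_distrib_left[symmetric] mult_ac)
      also have "\<dots> \<le> 2 * q * (E / (s * g))"
        using sum_norm_pair_le_mode_energy[OF G b \<kappa>, of u n w] s pos
        by (intro mult_left_mono) (auto simp: E_def s_def pos_le_divide_eq mult_ac)
      finally show ?thesis
        by (simp add: mult_left_mono)
    qed
    have young: "\<bar>\<xi>\<bar> * ((cmod (a u) + cmod (a w)) * (cmod (m u) + cmod (m w)))
        \<le> s * \<delta> * (D u + D w) + L * \<xi>\<^sup>2 * E"
    proof -
      (* The factor 2 stems from (|a u| + |a w|)^2 \<le> 2 (|a u|^2 + |a w|^2) \<le> 2 K (D u + D w). *)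
      define t where "t = s * \<delta> / (2 * K)"
      have t: "0 < t"
        using s pos K by (simp add: t_def)
      have young: "x * y \<le> t * x\<^sup>2 + y\<^sup>2 / (4 * t)" for x y :: real
      proof -
        have "t * x\<^sup>2 + y\<^sup>2 / (4 * t) - x * y = (2 * t * x - y)\<^sup>2 / (4 * t)"
          using t by (simp add: power2_eq_square field_simps)
        also have "\<dots> \<ge> 0"
          using t by simp
        finally show ?thesis by simp
      qed
      have "(cmod (a u) + cmod (a w))\<^sup>2 \<le> 2 * ((cmod (a u))\<^sup>2 + (cmod (a w))\<^sup>2)"
        by (rule square_sum)
      also have "\<dots> \<le> 2 * (K * D u + K * D w)"
        using a_bound by (intro mult_left_mono add_mono) auto
      finally have "t * (cmod (a u) + cmod (a w))\<^sup>2 \<le> t * (2 * (K * D u + K * D w))"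
        using t by (intro mult_left_mono) auto
      also have "\<dots> = s * \<delta> * (D u + D w)"
        using K by (simp add: t_def field_simps)
      finally have first: "t * (cmod (a u) + cmod (a w))\<^sup>2 \<le> s * \<delta> * (D u + D w)" .
      have "(\<bar>\<xi>\<bar> * (cmod (m u) + cmod (m w)))\<^sup>2 / (4 * t)
          \<le> \<xi>\<^sup>2 * (R\<^sup>2 * (2 * q * E / (s * g))) / (4 * t)"
        unfolding power_mult_distrib power2_abs using m_bound t
        by (intro divide_right_mono mult_left_mono) auto
      also have "\<dots> = L * \<xi>\<^sup>2 * E"
        using s pos K by (simp add: t_def L_def field_simps power2_eq_square)
      finally have second: "(\<bar>\<xi>\<bar> * (cmod (m u) + cmod (m w)))\<^sup>2 / (4 * t) \<le> L * \<xi>\<^sup>2 * E" .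
      have "\<bar>\<xi>\<bar> * ((cmod (a u) + cmod (a w)) * (cmod (m u) + cmod (m w)))
          = (cmod (a u) + cmod (a w)) * (\<bar>\<xi>\<bar> * (cmod (m u) + cmod (m w)))"
        by (simp add: mult_ac)
      also have "\<dots> \<le> t * (cmod (a u) + cmod (a w))\<^sup>2
          + (\<bar>\<xi>\<bar> * (cmod (m u) + cmod (m w)))\<^sup>2 / (4 * t)"
        by (rule young)
      finally show ?thesis
        using first second by linarith
    qed
    define Fu where "Fu = - (\<i> * \<xi> * (b *\<^sub>R (a u + (2 * \<beta>) *\<^sub>R m u) + (a w + (2 * \<beta>) *\<^sub>R m w)))"
    define Fw where "Fw = - (\<i> * \<xi> * ((1 - b\<^sup>2) *\<^sub>R (a u + (2 * \<beta>) *\<^sub>R m u)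
      - b *\<^sub>R (a w + (2 * \<beta>) *\<^sub>R m w)))"
    define r where "r = \<kappa> * Re (w (n + q) * cnj (m w))"
    have eqs: "(\<Sum>i=0..q. \<alpha> i *\<^sub>R u (n + i)) = Fu"
      "(\<Sum>i=0..q. \<alpha> i *\<^sub>R w (n + i)) = Fw - \<kappa> *\<^sub>R w (n + q)"
      using scheme unfolding mode_scheme_def Fu_def Fw_def \<gamma>_split[symmetric] by blast+
    have "G_energy G u (Suc n) - G_energy G u n + \<delta> * D u \<le> Re (Fu * cnj (m u))"
      using G_energy_step[OF G, of u n] unfolding eqs D_def m_def .
    then have "s * (G_energy G u (Suc n) - G_energy G u n + \<delta> * D u) \<le> s * Re (Fu * cnj (m u))"
      using s by (intro mult_left_mono) auto
    then have step_u: "s * G_energy G u (Suc n) + s * \<delta> * D u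
        \<le> s * G_energy G u n + s * Re (Fu * cnj (m u))"
      by (simp add: algebra_simps del: times_complex.sel)
    have "G_energy G w (Suc n) - G_energy G w n + \<delta> * D w
        \<le> Re ((Fw - \<kappa> *\<^sub>R w (n + q)) * cnj (m w))"
      using G_energy_step[OF G, of w n] unfolding eqs D_def m_def .
    also have "\<dots> = Re (Fw * cnj (m w)) - r"
      by (simp add: r_def algebra_simps)
    finally have step_w: "G_energy G w (Suc n) + \<delta> * D w
        \<le> G_energy G w n + Re (Fw * cnj (m w)) - r"
      by linarith
    have "s * Re (Fu * cnj (m u)) + Re (Fw * cnj (m w))
        \<le> \<bar>\<xi>\<bar> * ((cmod (a u) + cmod (a w)) * (cmod (m u) + cmod (m w)))"
      unfolding s_def Fu_def Fw_def by (rule flux_skew_estimate[OF b])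
    also note young
    finally have flux: "s * Re (Fu * cnj (m u)) + Re (Fw * cnj (m w))
        \<le> s * \<delta> * D u + s * \<delta> * D w + L * \<xi>\<^sup>2 * E"
      by (simp only: distrib_left)
    have "\<kappa> * (((cmod (w (n + q)))\<^sup>2 - (cmod (w (n + (q - 1))))\<^sup>2) / 4) \<le> r"
      unfolding m_def r_def using relaxation_dissipates \<kappa> by (rule mult_left_mono)
    then have stiff: "\<kappa> / 4 * (cmod (w (n + q)))\<^sup>2 \<le> \<kappa> / 4 * (cmod (w (n + (q - 1))))\<^sup>2 + r"
      by (simp add: algebra_simps)
    (* The second equation carries the weight 1 \<ge> s, so its dissipation suffices as well. *)
    have D_w: "s * \<delta> * D w \<le> \<delta> * D w"
      using mult_right_mono[OF s(2), of "\<delta> * D w"] pos D_nonneg by (simp add: mult.assoc)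
    have "Suc n + (q - 1) = n + q"
      using q by simp
    then have "mode_energy G q b \<kappa> u w (Suc n)
        = s * G_energy G u (Suc n) + G_energy G w (Suc n) + \<kappa> / 4 * (cmod (w (n + q)))\<^sup>2"
      by (simp only: mode_energy_def s_def)
    also have "\<dots> \<le> s * G_energy G u n + G_energy G w n
        + \<kappa> / 4 * (cmod (w (n + (q - 1))))\<^sup>2 + L * \<xi>\<^sup>2 * E"
      using step_u step_w flux stiff D_w by linarith
    also have "\<dots> = (1 + L * \<xi>\<^sup>2) * E"
      by (simp add: E_def mode_energy_def s_def distrib_right)
    finally show ?thesis
      unfolding E_def .
  qed
  show ?thesis
    by (intro exI[of _ L] conjI allI impI L step)
qed

text \<open>Discrete Gronwall: \<open>(1 + L \<xi>\<^sup>2)\<^sup>n \<le> exp (n L \<xi>\<^sup>2) \<le> exp (L c T)\<close>, since \<open>\<xi>\<^sup>2 \<le> c h\<close> and \<open>n h \<le> T\<close>.\<close>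
lemma mode_stability:
  fixes b c T :: real
  assumes G: "G_stable q \<alpha> G g M \<delta>" and q: "0 < q" and "\<alpha> q = 1"
    and "(\<Sum>i<q. \<gamma> i) = \<beta>" and b: "\<bar>b\<bar> < 1" and "0 \<le> c" and "0 \<le> T"
  shows "\<exists>C\<ge>0. \<forall>h \<kappa> \<xi> u w n. 0 < h \<longrightarrow> 0 \<le> \<kappa> \<longrightarrow> \<bar>\<xi>\<bar> \<le> c \<longrightarrow> \<xi>\<^sup>2 \<le> c * h \<longrightarrow>
    mode_scheme q \<alpha> \<gamma> b \<kappa> \<xi> u w \<longrightarrow> real n * h \<le> T \<longrightarrow>
    (cmod (u n))\<^sup>2 + (cmod (w n))\<^sup>2 \<le> C * (\<Sum>i<q. (cmod (u i))\<^sup>2 + (1 + \<kappa>) * (cmod (w i))\<^sup>2)"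
proof -
  from mode_energy_growth[OF assms(1-6)]
  obtain L where L: "0 \<le> L" and growth: "\<forall>\<kappa> \<xi> u w n. 0 \<le> \<kappa> \<longrightarrow> \<bar>\<xi>\<bar> \<le> c \<longrightarrow>
      mode_scheme q \<alpha> \<gamma> b \<kappa> \<xi> u w \<longrightarrow>
      mode_energy G q b \<kappa> u w (Suc n) \<le> (1 + L * \<xi>\<^sup>2) * mode_energy G q b \<kappa> u w n"
    by (elim exE conjE) (rule that)
  define s where "s = 1 - b\<^sup>2"
  have s: "0 < s" "s \<le> 1"
    using b by (auto simp: s_def abs_square_less_1)
  have pos: "0 < g"
    using G by (auto simp: G_stable_def)
  define C where "C = 1 + exp (L * c * T) * (\<bar>M\<bar> + 1) / (s * g)"
  have C: "1 \<le> C"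
    using s pos by (simp add: C_def)
  have bound: "(cmod (u n))\<^sup>2 + (cmod (w n))\<^sup>2
      \<le> C * (\<Sum>i<q. (cmod (u i))\<^sup>2 + (1 + \<kappa>) * (cmod (w i))\<^sup>2)"
    if h: "0 < h" and \<kappa>: "0 \<le> \<kappa>" and \<xi>: "\<bar>\<xi>\<bar> \<le> c" "\<xi>\<^sup>2 \<le> c * h"
      and scheme: "mode_scheme q \<alpha> \<gamma> b \<kappa> \<xi> u w" and n: "real n * h \<le> T" for h \<kappa> \<xi> u w n
  proof -
    define E where "E = mode_energy G q b \<kappa> u w"
    define I where "I = (\<Sum>i<q. (cmod (u i))\<^sup>2 + (1 + \<kappa>) * (cmod (w i))\<^sup>2)"
    have lower: "s * g * (\<Sum>i<q. (cmod (u (k + i)))\<^sup>2 + (cmod (w (k + i)))\<^sup>2) \<le> E k" for k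
      unfolding s_def E_def by (rule sum_norm_pair_le_mode_energy[OF G b \<kappa>])
    have "0 \<le> s * g * (\<Sum>i<q. (cmod (u (0 + i)))\<^sup>2 + (cmod (w (0 + i)))\<^sup>2)"
      using s pos by (intro mult_nonneg_nonneg sum_nonneg) auto
    then have E0: "0 \<le> E 0"
      using lower[of 0] by linarith
    have initial: "E 0 \<le> (\<bar>M\<bar> + 1) * I"
    proof -
      have upper: "G_energy G z 0 \<le> \<bar>M\<bar> * (\<Sum>i<q. (cmod (z i))\<^sup>2)" for z
        using G_energy_bounds(2)[OF G, of z 0]
        by (rule order.trans) (auto intro!: mult_right_mono sum_nonneg)
      have "0 \<le> g * (\<Sum>i<q. (cmod (u i))\<^sup>2)"
        using pos by (simp add: sum_nonneg)
      then have "0 \<le> G_energy G u 0"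
        using G_energy_bounds(1)[OF G, of u 0] by simp
      then have "s * G_energy G u 0 \<le> 1 * (\<bar>M\<bar> * (\<Sum>i<q. (cmod (u i))\<^sup>2))"
        using s upper[of u] by (intro mult_mono) auto
      moreover have "(cmod (w (q - 1)))\<^sup>2 \<le> (\<Sum>i<q. (cmod (w i))\<^sup>2)"
        using q by (intro member_le_sum) auto
      then have "\<kappa> / 4 * (cmod (w (q - 1)))\<^sup>2 \<le> \<kappa> * (\<Sum>i<q. (cmod (w i))\<^sup>2)"
        using \<kappa> by (intro mult_mono) auto
      ultimately have "E 0 \<le> \<bar>M\<bar> * (\<Sum>i<q. (cmod (u i))\<^sup>2) + \<bar>M\<bar> * (\<Sum>i<q. (cmod (w i))\<^sup>2)
          + \<kappa> * (\<Sum>i<q. (cmod (w i))\<^sup>2)"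
        using upper[of w] by (simp add: E_def mode_energy_def s_def)
      also have "\<dots> \<le> (\<bar>M\<bar> + 1) * I"
      proof -
        define X where "X = (\<Sum>i<q. (cmod (u i))\<^sup>2)"
        define Y where "Y = (\<Sum>i<q. (cmod (w i))\<^sup>2)"
        have "0 \<le> X" "0 \<le> Y" "0 \<le> \<bar>M\<bar> * (\<kappa> * Y)"
          using \<kappa> by (auto simp: X_def Y_def sum_nonneg)
        moreover have "I = X + (1 + \<kappa>) * Y"
          by (simp add: I_def X_def Y_def sum.distrib sum_distrib_left)
        ultimately show ?thesis
          unfolding X_def[symmetric] Y_def[symmetric] by (simp add: algebra_simps)
      qed
      finally show ?thesis .
    qed
    have iterate: "E k \<le> exp (L * c * T) * E 0" if "real k * h \<le> T" for k
    proof -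
      have "E k \<le> (1 + L * \<xi>\<^sup>2) ^ k * E 0"
      proof (induction k)
        case (Suc k)
        have "E (Suc k) \<le> (1 + L * \<xi>\<^sup>2) * E k"
          unfolding E_def by (rule growth[rule_format, OF \<kappa> \<xi>(1) scheme])
        also have "\<dots> \<le> (1 + L * \<xi>\<^sup>2) * ((1 + L * \<xi>\<^sup>2) ^ k * E 0)"
          using Suc.IH L by (intro mult_left_mono) auto
        finally show ?case by simp
      qed simp
      also have "\<dots> \<le> exp (L * \<xi>\<^sup>2) ^ k * E 0"
        using L E0 by (intro mult_right_mono power_mono exp_ge_add_one_self) auto
      also have "exp (L * \<xi>\<^sup>2) ^ k = exp (L * (real k * \<xi>\<^sup>2))"
        by (simp add: exp_of_nat_mult[symmetric] mult_ac)
      also have "\<dots> * E 0 \<le> exp (L * c * T) * E 0"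
      proof (intro mult_right_mono E0)
        have "real k * \<xi>\<^sup>2 \<le> real k * (c * h)"
          using \<xi>(2) by (intro mult_left_mono) auto
        also have "\<dots> = c * (real k * h)"
          by (simp add: mult_ac)
        also have "\<dots> \<le> c * T"
          using that \<open>0 \<le> c\<close> by (rule mult_left_mono)
        finally show "exp (L * (real k * \<xi>\<^sup>2)) \<le> exp (L * c * T)"
          using L by (simp add: mult.assoc mult_left_mono)
      qed
      finally show ?thesis .
    qed
    have I: "0 \<le> I"
      using \<kappa> by (auto simp: I_def intro!: sum_nonneg add_nonneg_nonneg)
    show ?thesis
    proof (cases "n < q")
      case True
      have "(cmod (u n))\<^sup>2 + (cmod (w n))\<^sup>2 \<le> (cmod (u n))\<^sup>2 + (1 + \<kappa>) * (cmod (w n))\<^sup>2"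
        using \<kappa> by (simp add: distrib_right)
      also have "\<dots> \<le> I"
        unfolding I_def using True \<kappa>
        by (intro member_le_sum[of n "{..<q}" "\<lambda>i. (cmod (u i))\<^sup>2 + (1 + \<kappa>) * (cmod (w i))\<^sup>2"]) auto
      also have "\<dots> \<le> C * I"
        using C I by (simp add: mult_le_cancel_right1)
      finally show ?thesis
        unfolding I_def .
    next
      case False
      (* The energy at level k sees the values at levels k, ..., k + q - 1. *)
      define k where "k = n - (q - 1)"
      have nk: "n = k + (q - 1)"
        using False by (simp add: k_def)
      have "(cmod (u n))\<^sup>2 + (cmod (w n))\<^sup>2 \<le> (\<Sum>i<q. (cmod (u (k + i)))\<^sup>2 + (cmod (w (k + i)))\<^sup>2)"
        unfolding nk using q
        by (intro member_le_sum[of "q - 1" "{..<q}" "\<lambda>i. (cmod (u (k + i)))\<^sup>2 + (cmod (w (k + i)))\<^sup>2"]) auto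
      then have "s * g * ((cmod (u n))\<^sup>2 + (cmod (w n))\<^sup>2) \<le> E k"
        using s pos by (intro order.trans[OF mult_left_mono lower]) auto
      also have "real k * h \<le> real n * h"
        using h by (intro mult_right_mono) (auto simp: nk)
      then have "E k \<le> exp (L * c * T) * E 0"
        using n by (intro iterate) auto
      also have "\<dots> \<le> exp (L * c * T) * ((\<bar>M\<bar> + 1) * I)"
        using initial by (rule mult_left_mono) simp
      finally have "(cmod (u n))\<^sup>2 + (cmod (w n))\<^sup>2 \<le> exp (L * c * T) * (\<bar>M\<bar> + 1) / (s * g) * I"
        using s pos by (simp add: pos_le_divide_eq mult_ac)
      also have "\<dots> \<le> C * I"
        unfolding C_def using I by (intro mult_right_mono) auto
      finally show ?thesis
        unfolding I_def .
    qed
  qed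
  have "0 \<le> C"
    using C by simp
  then show ?thesis
    by (intro exI[of _ C] conjI allI impI bound)
qed

section \<open>Trigonometric polynomials\<close>

definition trig_sum :: "nat \<Rightarrow> (int \<Rightarrow> complex) \<Rightarrow> real \<Rightarrow> complex" where
  "trig_sum N c x = (\<Sum>k = - int N..int N. c k * exp (\<i> * of_int k * complex_of_real x))"

lemma trig_polysE:
  assumes "f \<in> trig_polys N"
  obtains c where "f = trig_sum N c"
  using assms by (auto simp: trig_polys_def trig_sum_def fun_eq_iff)

lemma trig_sum_add: "trig_sum N c x + trig_sum N d x = trig_sum N (\<lambda>k. c k + d k) x"
  by (simp add: trig_sum_def sum.distrib algebra_simps)

lemma trig_sum_diff: "trig_sum N c x - trig_sum N d x = trig_sum N (\<lambda>k. c k - d k) x"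
  by (simp add: trig_sum_def sum_subtractf algebra_simps)

lemma trig_sum_scaleR: "r *\<^sub>R trig_sum N c x = trig_sum N (\<lambda>k. r *\<^sub>R c k) x"
  by (simp add: trig_sum_def scaleR_right.sum)

lemma trig_sum_sum: "(\<Sum>i\<in>I. trig_sum N (c i) x) = trig_sum N (\<lambda>k. \<Sum>i\<in>I. c i k) x"
  unfolding trig_sum_def by (subst sum.swap) (simp add: sum_distrib_right)

lemma ddx_trig_sum: "ddx (trig_sum N c) x = trig_sum N (\<lambda>k. \<i> * of_int k * c k) x"
proof (rule vector_derivative_at)
  have "((\<lambda>x. c k * exp (\<i> * of_int k * complex_of_real x)) has_vector_derivative
      \<i> * of_int k * c k * exp (\<i> * of_int k * complex_of_real x)) (at x)" for k
    by (rule has_vector_derivative_eq_rhs, rule has_vector_derivative_real_field)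
      (auto intro!: derivative_eq_intros)
  then show "(trig_sum N c has_vector_derivative trig_sum N (\<lambda>k. \<i> * of_int k * c k) x) (at x)"
    unfolding trig_sum_def[abs_def] by (auto intro!: has_vector_derivative_sum)
qed

text \<open>For \<open>m \<noteq> 0\<close> the antiderivative \<open>exp (\<i> m x) / (\<i> m)\<close> is \<open>2\<pi>\<close>-periodic.\<close>
lemma has_integral_exp_mode:
  fixes m :: int
  shows "((\<lambda>x. exp (\<i> * of_int m * complex_of_real x)) has_integral
    (if m = 0 then 2 * of_real pi else 0)) {0..2 * pi}"
proof (cases "m = 0")
  case True
  then show ?thesis
    using has_integral_const_real[of "1::complex" 0 "2 * pi"]
    by (simp add: scaleR_conv_of_real)
next
  case False
  define F where "F x = exp (\<i> * of_int m * complex_of_real x) / (\<i> * of_int m)" for x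
  have "((\<lambda>x. exp (\<i> * of_int m * complex_of_real x)) has_integral F (2 * pi) - F 0) {0..2 * pi}"
  proof (rule fundamental_theorem_of_calculus)
    fix x :: real
    have "(F has_vector_derivative exp (\<i> * of_int m * complex_of_real x)) (at x)"
      unfolding F_def
      by (rule has_vector_derivative_eq_rhs, rule has_vector_derivative_real_field)
        (use False in \<open>auto intro!: derivative_eq_intros\<close>)
    then show "(F has_vector_derivative exp (\<i> * of_int m * complex_of_real x))
        (at x within {0..2 * pi})"
      by (rule has_vector_derivative_at_within)
  qed simp
  moreover have "F (2 * pi) = F 0"
  proof -
    have "exp (\<i> * of_int m * complex_of_real (2 * pi)) = 1"
      using exp_integer_2pi[of "of_int m"] by (simp add: mult_ac)
    then show ?thesis
      by (simp add: F_def)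
  qed
  ultimately show ?thesis
    using False by simp
qed

lemma parseval_trig_sum:
  "(L2norm (trig_sum N c))\<^sup>2 = 2 * pi * (\<Sum>k = - int N..int N. (cmod (c k))\<^sup>2)"
proof -
  define I where "I = {- int N..int N}"
  let ?e = "\<lambda>k x. exp (\<i> * of_int k * complex_of_real x)"
  have cont: "continuous_on {0..2 * pi} (\<lambda>x. (cmod (trig_sum N c x))\<^sup>2)"
    unfolding trig_sum_def by (intro continuous_intros)
  have sq: "complex_of_real ((cmod (trig_sum N c x))\<^sup>2)
      = (\<Sum>k\<in>I. \<Sum>l\<in>I. c k * cnj (c l) * ?e (k - l) x)" for x
    unfolding complex_norm_square trig_sum_def I_def[symmetric] cnj_sum sum_product
    by (intro sum.cong refl) (simp add: exp_cnj algebra_simps exp_add[symmetric])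
  have "((\<lambda>x. \<Sum>k\<in>I. \<Sum>l\<in>I. c k * cnj (c l) * ?e (k - l) x) has_integral
      (\<Sum>k\<in>I. \<Sum>l\<in>I. c k * cnj (c l) * (if k - l = 0 then 2 * of_real pi else 0))) {0..2 * pi}"
    by (intro has_integral_sum has_integral_mult_right has_integral_exp_mode) (auto simp: I_def)
  also have "(\<Sum>k\<in>I. \<Sum>l\<in>I. c k * cnj (c l) * (if k - l = 0 then 2 * of_real pi else 0))
      = (\<Sum>k\<in>I. c k * cnj (c k) * (2 * of_real pi))"
  proof (rule sum.cong)
    fix k assume "k \<in> I"
    have "(\<Sum>l\<in>I. c k * cnj (c l) * (if k - l = 0 then 2 * of_real pi else 0))
        = (\<Sum>l\<in>I. if k = l then c k * cnj (c l) * (2 * of_real pi) else 0)"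
      by (intro sum.cong) auto
    then show "(\<Sum>l\<in>I. c k * cnj (c l) * (if k - l = 0 then 2 * of_real pi else 0))
        = c k * cnj (c k) * (2 * of_real pi)"
      using \<open>k \<in> I\<close> by (simp add: I_def)
  qed simp
  also have "\<dots> = complex_of_real (2 * pi * (\<Sum>k\<in>I. (cmod (c k))\<^sup>2))"
    by (simp add: complex_norm_square[symmetric] sum_distrib_left mult_ac)
  finally have "((\<lambda>x. complex_of_real ((cmod (trig_sum N c x))\<^sup>2)) has_integral
      complex_of_real (2 * pi * (\<Sum>k\<in>I. (cmod (c k))\<^sup>2))) {0..2 * pi}"
    unfolding sq .
  from has_integral_linear[OF this bounded_linear_Re]
  have "((\<lambda>x. (cmod (trig_sum N c x))\<^sup>2) has_integral 2 * pi * (\<Sum>k\<in>I. (cmod (c k))\<^sup>2)) {0..2 * pi}"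
    by (simp only: o_def Re_complex_of_real)
  moreover have "set_lebesgue_integral lborel {0..2 * pi} (\<lambda>x. (cmod (trig_sum N c x))\<^sup>2)
      = integral {0..2 * pi} (\<lambda>x. (cmod (trig_sum N c x))\<^sup>2)"
    by (intro set_borel_integral_eq_integral borel_integrable_atLeastAtMost' cont)
  ultimately show ?thesis
    by (simp add: L2norm_def I_def integral_unique sum_nonneg)
qed

text \<open>Linear independence of the exponentials is a consequence of Parseval's identity. It allows
  comparing coefficients in the scheme.\<close>
lemma trig_sum_eq_0D:
  assumes "\<And>x. trig_sum N c x = 0" and "\<bar>k\<bar> \<le> int N"
  shows "c k = 0"
proof -
  have "trig_sum N c = trig_sum N (\<lambda>_. 0)"
    using assms(1) by (simp add: fun_eq_iff trig_sum_def)
  then have "(\<Sum>k = - int N..int N. (cmod (c k))\<^sup>2) = 0"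
    using parseval_trig_sum[of N c] parseval_trig_sum[of N "\<lambda>_. 0"] by simp
  then have "\<forall>k\<in>{- int N..int N}. c k = 0"
    by (subst (asm) sum_nonneg_eq_0_iff) auto
  then show ?thesis
    using assms(2) by (simp add: abs_le_iff)
qed

section \<open>Stability of the schemes\<close>

lemma imex_bdf_scheme_modes:
  assumes U: "\<And>n. U n = trig_sum N (c n)" and W: "\<And>n. W n = trig_sum N (d n)"
    and scheme: "imex_bdf_scheme q b \<epsilon> h U W" and k: "\<bar>k\<bar> \<le> int N"
  shows "mode_scheme q (bdf_alpha q) (bdf_gamma q) b (bdf_beta q * h / \<epsilon>) (h * of_int k)
    (\<lambda>n. c n k) (\<lambda>n. d n k)"
  unfolding mode_scheme_def
proof (intro allI conjI)
  fix n
  have flux1: "ddx (\<lambda>y. b *\<^sub>R U m y + W m y) x = trig_sum N (\<lambda>k. \<i> * of_int k * (b *\<^sub>R c m k + d m k)) x"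
    for m x
    unfolding U W trig_sum_scaleR trig_sum_add by (rule ddx_trig_sum)
  have flux2: "ddx (\<lambda>y. (1 - b\<^sup>2) *\<^sub>R U m y - b *\<^sub>R W m y) x
      = trig_sum N (\<lambda>k. \<i> * of_int k * ((1 - b\<^sup>2) *\<^sub>R c m k - b *\<^sub>R d m k)) x" for m x
    unfolding U W trig_sum_scaleR trig_sum_diff by (rule ddx_trig_sum)
  have "(\<Sum>i=0..q. bdf_alpha q i *\<^sub>R c (n + i) k) + h *\<^sub>R (\<Sum>i<q. bdf_gamma q i *\<^sub>R
      (\<i> * of_int k * (b *\<^sub>R c (n + i) k + d (n + i) k))) = 0"
    by (rule trig_sum_eq_0D[of N _ k, OF _ k])
      (use scheme[unfolded imex_bdf_scheme_def flux1]
        in \<open>simp only: U W trig_sum_scaleR trig_sum_sum trig_sum_add\<close>)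
  then show "(\<Sum>i=0..q. bdf_alpha q i *\<^sub>R c (n + i) k)
      = - (\<i> * complex_of_real (h * of_int k) * (b *\<^sub>R (\<Sum>i<q. bdf_gamma q i *\<^sub>R c (n + i) k)
        + (\<Sum>i<q. bdf_gamma q i *\<^sub>R d (n + i) k)))"
    by (simp add: add_eq_0_iff2 scaleR_conv_of_real sum_distrib_left sum.distrib algebra_simps)
  have "(\<Sum>i=0..q. bdf_alpha q i *\<^sub>R d (n + i) k) + h *\<^sub>R (\<Sum>i<q. bdf_gamma q i *\<^sub>R
      (\<i> * of_int k * ((1 - b\<^sup>2) *\<^sub>R c (n + i) k - b *\<^sub>R d (n + i) k)))
      + (bdf_beta q * h / \<epsilon>) *\<^sub>R d (n + q) k = 0"
    by (rule trig_sum_eq_0D[of N _ k, OF _ k])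
      (use scheme[unfolded imex_bdf_scheme_def flux2]
        in \<open>simp only: U W eq_neg_iff_add_eq_0 trig_sum_scaleR trig_sum_sum trig_sum_add\<close>)
  then show "(\<Sum>i=0..q. bdf_alpha q i *\<^sub>R d (n + i) k)
      = - (\<i> * complex_of_real (h * of_int k) * ((1 - b\<^sup>2) *\<^sub>R (\<Sum>i<q. bdf_gamma q i *\<^sub>R c (n + i) k)
        - b *\<^sub>R (\<Sum>i<q. bdf_gamma q i *\<^sub>R d (n + i) k))) - (bdf_beta q * h / \<epsilon>) *\<^sub>R d (n + q) k"
    by (simp add: scaleR_conv_of_real sum_distrib_left sum.distrib sum_subtractf algebra_simps
        add_eq_0_iff2)
qed

theorem theorem3p8:
  fixes b T c_CFL :: real and q :: nat
  assumes "\<bar>b\<bar> < 1" and "q \<in> {1, 2, 3, 4}" and "0 \<le> T" and "c_CFL > 0"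
  shows "\<exists>C::real. \<forall>(T\<^sub>0::real) (\<epsilon>::real) (N::nat) (\<Delta>t::real)
           (U :: nat \<Rightarrow> real \<Rightarrow> complex) (W :: nat \<Rightarrow> real \<Rightarrow> complex).
           0 \<le> T\<^sub>0 \<longrightarrow> T\<^sub>0 \<le> T \<longrightarrow> \<epsilon> > 0 \<longrightarrow> N \<ge> 1 \<longrightarrow> \<Delta>t > 0 \<longrightarrow> \<Delta>t \<le> c_CFL / (real N)\<^sup>2 \<longrightarrow>
           (\<forall>n. U n \<in> trig_polys N \<and> W n \<in> trig_polys N) \<longrightarrow>
           imex_bdf_scheme q b \<epsilon> \<Delta>t U W \<longrightarrow>
           (\<forall>n. T\<^sub>0 + real n * \<Delta>t \<le> T \<longrightarrow>
              (L2norm (U n))\<^sup>2 + (L2norm (W n))\<^sup>2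
                \<le> C * (\<Sum>i<q. (L2norm (U i))\<^sup>2 + (1 + \<Delta>t / \<epsilon>) * (L2norm (W i))\<^sup>2))"
proof -
  have q: "1 \<le> q"
    using assms(2) by auto
  obtain G g M \<delta> where "G_stable q (bdf_alpha q) G g M \<delta>"
    using bdf_G_stable[OF assms(2)] by blast
  from mode_stability[of q "bdf_alpha q" G g M \<delta> "bdf_gamma q" "bdf_beta q" b c_CFL T,
      OF this _ bdf_alpha_lead[OF q] sum_bdf_gamma[OF q] assms(1)] q assms(3,4)
  have "\<exists>C\<ge>0. \<forall>h \<kappa> \<xi> u w n. 0 < h \<longrightarrow> 0 \<le> \<kappa> \<longrightarrow> \<bar>\<xi>\<bar> \<le> c_CFL \<longrightarrow> \<xi>\<^sup>2 \<le> c_CFL * h \<longrightarrow>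
      mode_scheme q (bdf_alpha q) (bdf_gamma q) b \<kappa> \<xi> u w \<longrightarrow> real n * h \<le> T \<longrightarrow>
      (cmod (u n))\<^sup>2 + (cmod (w n))\<^sup>2 \<le> C * (\<Sum>i<q. (cmod (u i))\<^sup>2 + (1 + \<kappa>) * (cmod (w i))\<^sup>2)"
    by simp
  then obtain C where "0 \<le> C" and mode: "\<forall>h \<kappa> \<xi> u w n. 0 < h \<longrightarrow> 0 \<le> \<kappa> \<longrightarrow> \<bar>\<xi>\<bar> \<le> c_CFL \<longrightarrow>
      \<xi>\<^sup>2 \<le> c_CFL * h \<longrightarrow> mode_scheme q (bdf_alpha q) (bdf_gamma q) b \<kappa> \<xi> u w \<longrightarrow> real n * h \<le> T \<longrightarrow>
      (cmod (u n))\<^sup>2 + (cmod (w n))\<^sup>2 \<le> C * (\<Sum>i<q. (cmod (u i))\<^sup>2 + (1 + \<kappa>) * (cmod (w i))\<^sup>2)"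
    by (elim exE conjE) (rule that)
  show ?thesis
  proof (intro exI[of _ C] allI impI)
    fix T\<^sub>0 \<epsilon> h :: real and N n :: nat and U W :: "nat \<Rightarrow> real \<Rightarrow> complex"
    assume T\<^sub>0: "0 \<le> T\<^sub>0" and \<epsilon>: "0 < \<epsilon>" and N: "1 \<le> N" and h: "0 < h" "h \<le> c_CFL / (real N)\<^sup>2"
      and UW: "\<forall>n. U n \<in> trig_polys N \<and> W n \<in> trig_polys N"
      and scheme: "imex_bdf_scheme q b \<epsilon> h U W" and n: "T\<^sub>0 + real n * h \<le> T"
    have "\<forall>n. \<exists>c. U n = trig_sum N c" "\<forall>n. \<exists>d. W n = trig_sum N d"
      using UW trig_polysE by metis+
    then obtain c d where U: "\<And>n. U n = trig_sum N (c n)" and W: "\<And>n. W n = trig_sum N (d n)"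
      by metis
    define \<kappa> where "\<kappa> = bdf_beta q * h / \<epsilon>"
    have \<kappa>: "0 \<le> \<kappa>" "\<kappa> \<le> h / \<epsilon>"
      using bdf_beta_pos[OF q] bdf_beta_le_1[OF q] h \<epsilon>
      by (auto simp: \<kappa>_def intro!: divide_right_mono)
    have CFL: "h * (real N)\<^sup>2 \<le> c_CFL"
      using h N by (simp add: pos_le_divide_eq)
    have k_bound: "(cmod (c n k))\<^sup>2 + (cmod (d n k))\<^sup>2
        \<le> C * (\<Sum>i<q. (cmod (c i k))\<^sup>2 + (1 + \<kappa>) * (cmod (d i k))\<^sup>2)" if k: "\<bar>k\<bar> \<le> int N" for k
    proof (rule mode[rule_format, OF h(1) \<kappa>(1)])
      have k': "\<bar>real_of_int k\<bar> \<le> real N"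
        using k by linarith
      (* N \<ge> 1 implies N \<le> N^2, so the step size restriction also bounds |\<xi>| itself. *)
      have "\<bar>h * real_of_int k\<bar> \<le> h * real N"
        using h k' by (simp add: abs_mult)
      also have "\<dots> \<le> h * (real N)\<^sup>2"
        using h N by (simp add: power2_eq_square)
      finally show "\<bar>h * real_of_int k\<bar> \<le> c_CFL"
        using CFL by linarith
      have "(real_of_int k)\<^sup>2 \<le> (real N)\<^sup>2"
        using power_mono[OF k', of 2] by simp
      then have "(h * real_of_int k)\<^sup>2 \<le> h * (h * (real N)\<^sup>2)"
        using h by (simp add: power_mult_distrib power2_eq_square[of h])
      also have "\<dots> \<le> h * c_CFL"
        using CFL h by (intro mult_left_mono) auto
      finally show "(h * real_of_int k)\<^sup>2 \<le> c_CFL * h"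
        by (simp add: mult.commute)
      show "mode_scheme q (bdf_alpha q) (bdf_gamma q) b \<kappa> (h * real_of_int k) (\<lambda>n. c n k) (\<lambda>n. d n k)"
        unfolding \<kappa>_def by (rule imex_bdf_scheme_modes[OF U W scheme k])
      show "real n * h \<le> T"
        using n T\<^sub>0 by simp
    qed
    have "(L2norm (U n))\<^sup>2 + (L2norm (W n))\<^sup>2
        = 2 * pi * (\<Sum>k = - int N..int N. (cmod (c n k))\<^sup>2 + (cmod (d n k))\<^sup>2)"
      by (simp add: U W parseval_trig_sum sum.distrib distrib_left)
    also have "\<dots> \<le> 2 * pi * (\<Sum>k = - int N..int N.
        C * (\<Sum>i<q. (cmod (c i k))\<^sup>2 + (1 + \<kappa>) * (cmod (d i k))\<^sup>2))"
      by (intro mult_left_mono sum_mono k_bound) auto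
    also have "\<dots> = C * (\<Sum>i<q. 2 * pi * (\<Sum>k = - int N..int N.
        (cmod (c i k))\<^sup>2 + (1 + \<kappa>) * (cmod (d i k))\<^sup>2))"
      by (subst (2) sum_distrib_left[symmetric], subst sum_distrib_left[symmetric], subst sum.swap)
        (simp add: mult_ac)
    also have "\<dots> = C * (\<Sum>i<q. (L2norm (U i))\<^sup>2 + (1 + \<kappa>) * (L2norm (W i))\<^sup>2)"
      by (simp add: U W parseval_trig_sum sum.distrib distrib_left sum_distrib_left[symmetric] mult_ac)
    also have "\<dots> \<le> C * (\<Sum>i<q. (L2norm (U i))\<^sup>2 + (1 + h / \<epsilon>) * (L2norm (W i))\<^sup>2)"
      using \<kappa> \<open>0 \<le> C\<close> by (intro mult_left_mono sum_mono add_left_mono mult_right_mono) auto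
    finally show "(L2norm (U n))\<^sup>2 + (L2norm (W n))\<^sup>2
        \<le> C * (\<Sum>i<q. (L2norm (U i))\<^sup>2 + (1 + h / \<epsilon>) * (L2norm (W i))\<^sup>2)" .
  qed
qed

end
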